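(* Let $A$ be an arbitrary, possibly infinite, nonempty set. For any set $\mathcal{F} \subseteq \mathcal{O}_A$ of operations on $A$, the following two conditions are equivalent: (i) $\mathcal{F}$ is locally closed and closed under permutation of variables, addition of dummy variables, and composition. (ii) $\mathcal{F}$ is characterized by some set $\mathcal{W} \subseteq \mathcal{W}_A$ of systems of pointed multisets, i.e., there is $\mathcal{W} \subseteq \mathcal{W}_A$ such that $\mathcal{F} = \{f \in \mathcal{O}_A \mid f \text{ preserves } (\Phi,\Phi') \text{ for all } (\Phi,\Phi') \in \mathcal{W}\}$.
   Context: An operation on $A$ is a map $f\colon A^n \to A$ for some integer $n \ge 1$ (its arity); $\mathcal{O}_A$ is the set of all operations on $A$, $\mathcal{O}_A^{(n)}$ the set of $n$-ary ones, and $\mathcal{F}^{(n)} := \mathcal{F} \cap \mathcal{O}_A^{(n)}$. For $f \in \mathcal{O}_A^{(n)}$ and $g \in \mathcal{O}_A^{(m)}$ define: $(\zeta f)(x_1,\dots,x_n) := f(x_2,\dots,x_n,x_1)$ and $(\tau f)(x_1,\dots,x_n) := f(x_2,x_1,x_3,\dots,x_n)$ for $n>1$, with $\zeta f=\tau f=f$ for $n=1$; $(\nabla f)(x_1,\dots,x_{n+1}) := f(x_2,\dots,x_{n+1})$; $(f \ast g)(x_1,\dots,x_{m+n-1}) := f(g(x_1,\dots,x_m),x_{m+1},\dots,x_{m+n-1})$. Closed under permutation of variables means closed under $\zeta$ and $\tau$; closed under addition of dummy variables means closed under $\nabla$; closed under composition means closed under $\ast$. $\mathcal{F}$ is locally closed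 if for every $f \in \mathcal{O}_A$, say of arity $n$, we have $f\in\mathcal{F}$ whenever for every finite $F \subseteq A^n$ there is $g \in \mathcal{F}^{(n)}$ with $f|_F = g|_F$. $\mathcal{M}(B)$ denotes the set of finite multisets on a set $B$ (multiplicity functions $\nu_S\colon B \to \{0,1,2,\dots\}$ with finite support); $S' \subseteq S$ means $\nu_{S'} \le \nu_S$ pointwise, and $\uplus$ is addition of multiplicities. For $m \ge 1$, an $m$-ary system of pointed multisets on $A$ is a pair $(\Phi,\Phi')$ with $\Phi \subseteq \mathcal{M}(A^m)$ and $\Phi' \subseteq A^m \times \mathcal{M}(A^m)$ such that (1) $(x,S) \in \Phi'$ and $S' \subseteq S$ imply $(x,S') \in \Phi'$; (2) $(x,S)\in\Phi'$ implies $\{x\}\uplus S \in \Phi$. $\mathcal{W}_A$ is the set of all systems of pointed multisets on $A$, of all arities $m\ge 1$. A matrix $\mathbf{M} \in A^{m\times p}$, $p \ge 0$, is a $p$-tuple of columns in $A^m$; $\mathbf{M}^*$ is its multiset of columns; $[\mathbf{M}_1|\mathbf{M}_2]$ is horizontal concatenation; for $f$ of arity $n$ and $\mathbf{M}_1 \in A^{m \times n}$, $f\mathbf{M}_1 \in A^m$ is obtained by applying $f$ to each row of $\mathbf{M}_1$. $\mathbf{M} \prec \Phi$ means $\mathbf{M}^* \in \Phi$; for $\mathbf{M} = (\mathbf{m}_1,\dots,\mathbf{m}_p)$ with $p\ge1$, $\mathbf{M} \prec \Phi'$ means $(\mathbf{m}_1,\{\mathbf{m}_2,\dots,\mathbf{m}_p\})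 \in \Phi'$. An $n$-ary operation $f$ preserves the $m$-ary system $(\Phi,\Phi')$ if for every matrix $\mathbf{M} = [\mathbf{M}_1|\mathbf{M}_2]$ with $m$ rows and finitely many columns, where $\mathbf{M}_1$ has $n$ columns and $\mathbf{M}_2$ may be empty, $\mathbf{M}\prec\Phi$ implies $[f\mathbf{M}_1|\mathbf{M}_2]\prec\Phi'$. *)

theory Defs
  imports "HOL-Library.FuncSet" "HOL-Library.Multiset"
begin

definition tuples :: "'a set \<Rightarrow> nat \<Rightarrow> 'a list set" where
  "tuples A n = {xs. length xs = n \<and> set xs \<subseteq> A}"

text \<open>
  An operation is a pair of its arity \<open>n\<close> and a map from \<open>A\<^sup>n\<close> to \<open>A\<close>. The map is extensional
  (it is \<open>undefined\<close> outside \<open>A\<^sup>n\<close>), so that equality of pairs is equality of operations.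
\<close>

type_synonym 'a oper = "nat \<times> ('a list \<Rightarrow> 'a)"

definition operations :: "'a set \<Rightarrow> 'a oper set" where
  "operations A = {(n, f). n \<ge> 1 \<and> f \<in> tuples A n \<rightarrow>\<^sub>E A}"

fun op_zeta :: "'a set \<Rightarrow> 'a oper \<Rightarrow> 'a oper" where
  "op_zeta A (n, f) = (n, \<lambda>xs\<in>tuples A n. f (rotate1 xs))"

fun swap_first :: "'a list \<Rightarrow> 'a list" where
  "swap_first (x # y # zs) = y # x # zs"
| "swap_first xs = xs"

fun op_tau :: "'a set \<Rightarrow> 'a oper \<Rightarrow> 'a oper" where
  "op_tau A (n, f) = (n, \<lambda>xs\<in>tuples A n. f (swap_first xs))"

fun op_nabla :: "'a set \<Rightarrow> 'a oper \<Rightarrow> 'a oper" where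
  "op_nabla A (n, f) = (n + 1, \<lambda>xs\<in>tuples A (n + 1). f (tl xs))"

fun op_comp :: "'a set \<Rightarrow> 'a oper \<Rightarrow> 'a oper \<Rightarrow> 'a oper" where
  "op_comp A (n, f) (m, g) =
     (m + n - 1, \<lambda>xs\<in>tuples A (m + n - 1). f (g (take m xs) # drop m xs))"

definition closed_permutation :: "'a set \<Rightarrow> 'a oper set \<Rightarrow> bool" where
  "closed_permutation A F \<longleftrightarrow> (\<forall>f\<in>F. op_zeta A f \<in> F \<and> op_tau A f \<in> F)"

definition closed_dummy :: "'a set \<Rightarrow> 'a oper set \<Rightarrow> bool" where
  "closed_dummy A F \<longleftrightarrow> (\<forall>f\<in>F. op_nabla A f \<in> F)"

definition closed_composition :: "'a set \<Rightarrow> 'a oper set \<Rightarrow> bool" where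
  "closed_composition A F \<longleftrightarrow> (\<forall>f\<in>F. \<forall>g\<in>F. op_comp A f g \<in> F)"

definition locally_closed :: "'a set \<Rightarrow> 'a oper set \<Rightarrow> bool" where
  "locally_closed A F \<longleftrightarrow>
     (\<forall>(n, f)\<in>operations A.
        (\<forall>X. finite X \<and> X \<subseteq> tuples A n \<longrightarrow> (\<exists>g. (n, g) \<in> F \<and> (\<forall>x\<in>X. f x = g x)))
          \<longrightarrow> (n, f) \<in> F)"

text \<open>
  A system \<open>(\<Phi>, \<Phi>')\<close> carries its arity \<open>m\<close> explicitly, since \<open>m\<close> is not determined
  by \<open>\<Phi>\<close> and \<open>\<Phi>'\<close> when these are empty.
\<close>

type_synonym 'a pms = "nat \<times> 'a list multiset set \<times> ('a list \<times> 'a list multiset) set"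

definition multisets_on :: "'b set \<Rightarrow> 'b multiset set" where
  "multisets_on B = {S. set_mset S \<subseteq> B}"

definition pointed_multiset_systems :: "'a set \<Rightarrow> 'a pms set" where
  "pointed_multiset_systems A =
     {(m, \<Phi>, \<Phi>').
        m \<ge> 1 \<and> \<Phi> \<subseteq> multisets_on (tuples A m) \<and>
        \<Phi>' \<subseteq> tuples A m \<times> multisets_on (tuples A m) \<and>
        (\<forall>x S S'. (x, S) \<in> \<Phi>' \<and> S' \<subseteq># S \<longrightarrow> (x, S') \<in> \<Phi>') \<and>
        (\<forall>x S. (x, S) \<in> \<Phi>' \<longrightarrow> {#x#} + S \<in> \<Phi>)}"

text \<open>A matrix with \<open>m\<close> rows and \<open>p\<close> columns is the list of its columns.\<close>

definition matrices :: "'a set \<Rightarrow> nat \<Rightarrow> nat \<Rightarrow> 'a list list set" where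
  "matrices A m p = tuples (tuples A m) p"

definition apply_rows :: "nat \<Rightarrow> ('a list \<Rightarrow> 'a) \<Rightarrow> 'a list list \<Rightarrow> 'a list" where
  "apply_rows m f M = map (\<lambda>i. f (map (\<lambda>c. c ! i) M)) [0..<m]"

definition prec :: "'a list list \<Rightarrow> 'a list multiset set \<Rightarrow> bool" where
  "prec M \<Phi> \<longleftrightarrow> mset M \<in> \<Phi>"

definition prec_pointed :: "'a list list \<Rightarrow> ('a list \<times> 'a list multiset) set \<Rightarrow> bool" where
  "prec_pointed M \<Phi>' \<longleftrightarrow> M \<noteq> [] \<and> (hd M, mset (tl M)) \<in> \<Phi>'"

fun preserves :: "'a set \<Rightarrow> 'a oper \<Rightarrow> 'a pms \<Rightarrow> bool" where
  "preserves A (n, f) (m, \<Phi>, \<Phi>') \<longleftrightarrow>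
     (\<forall>p. \<forall>M\<^sub>1\<in>matrices A m n. \<forall>M\<^sub>2\<in>matrices A m p.
        prec (M\<^sub>1 @ M\<^sub>2) \<Phi> \<longrightarrow> prec_pointed ([apply_rows m f M\<^sub>1] @ M\<^sub>2) \<Phi>')"

end

theory Submission
  imports Defs
begin

text \<open>
  Each closure condition in (i) corresponds to a feature of preservation: permutation of variables
  to the fact that multisets forget the order of columns, dummy variables to the downward closure of
  \<open>\<Phi>'\<close>, composition to the passage from \<open>\<Phi>'\<close> back to \<open>\<Phi>\<close>, and local closure to the finite number
  of rows. This gives (ii) \<open>\<Longrightarrow>\<close> (i).

  For the converse, call a column \<open>x\<close> derivable from a multiset \<open>T\<close> of columns if \<open>x = h N\<close>, where
  \<open>h\<close> is in \<open>F\<close> and \<open>N\<close> lists the elements of \<open>T\<close>, each used exactly as often as it occurs. Closure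
  under permutation, dummy variables and composition say respectively that the order of \<open>N\<close> does not
  matter (\<open>in_derivable_iff\<close>), that derivability is monotone in \<open>T\<close> (\<open>derivable_mono\<close>), and that
  it admits cut (\<open>derivable_cut\<close>). Fix \<open>T\<close>, and let \<open>\<Phi>\<close> consist of the multisets from which nothing is
  derivable that is not derivable from \<open>T\<close>; let \<open>\<Phi>'\<close> consist of the pairs \<open>(x, S)\<close> with \<open>x\<close> derivable
  from \<open>T\<close> and \<open>{x} \<uplus> S\<close> in \<open>\<Phi>\<close>. Monotonicity and cut show that \<open>F\<close> preserves this system.
  Conversely, let \<open>f\<close> preserve all these systems, and let \<open>X\<close> be a finite set of arguments of \<open>f\<close>.
  If the elements of \<open>X\<close> are the rows of \<open>M\<close> and \<open>T\<close> is the multiset of columns of \<open>M\<close>, then \<open>T\<close>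
  is in \<open>\<Phi>\<close>, so \<open>f M\<close> is derivable from \<open>T\<close>. That is, some \<open>h\<close> in \<open>F\<close> satisfies \<open>h M = f M\<close>, and so
  \<open>f\<close> agrees with \<open>h\<close> on \<open>X\<close>. Local closure puts \<open>f\<close> into \<open>F\<close>.
\<close>

section \<open>Operations applied to the rows of a matrix\<close>

lemma swap_first_map: "swap_first (map g xs) = map g (swap_first xs)"
  by (induction xs rule: swap_first.induct) auto

lemma mset_swap_first [simp]: "mset (swap_first xs) = mset xs"
  by (induction xs rule: swap_first.induct) auto

lemma mset_rotate1 [simp]: "mset (rotate1 xs) = mset xs"
  by (cases xs) auto

lemma tuples_cong_mset: "mset xs = mset ys \<Longrightarrow> xs \<in> tuples B n \<longleftrightarrow> ys \<in> tuples B n"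
  by (metis (mono_tags, lifting) mem_Collect_eq mset_eq_length mset_eq_setD tuples_def)

lemma row_in_tuples: "M \<in> matrices A m n \<Longrightarrow> i < m \<Longrightarrow> map (\<lambda>c. c ! i) M \<in> tuples A n"
  by (force simp: matrices_def tuples_def)

lemma apply_rows_cong:
  "(\<And>i. i < m \<Longrightarrow> f (map (\<lambda>c. c ! i) M) = g (map (\<lambda>c. c ! i) N)) \<Longrightarrow>
    apply_rows m f M = apply_rows m g N"
  by (simp add: apply_rows_def)

lemma apply_rows_in_tuples:
  assumes "(n, f) \<in> operations A" "M \<in> matrices A m n"
  shows "apply_rows m f M \<in> tuples A m"
  using assms row_in_tuples[OF assms(2)]
  by (auto simp: apply_rows_def operations_def tuples_def PiE_iff)

lemma apply_rows_zeta:
  "M \<in> matrices A m n \<Longrightarrow>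
    apply_rows m (\<lambda>xs\<in>tuples A n. f (rotate1 xs)) M = apply_rows m f (rotate1 M)"
  by (rule apply_rows_cong) (simp add: row_in_tuples rotate1_map)

lemma apply_rows_tau:
  "M \<in> matrices A m n \<Longrightarrow>
    apply_rows m (\<lambda>xs\<in>tuples A n. f (swap_first xs)) M = apply_rows m f (swap_first M)"
  by (rule apply_rows_cong) (simp add: row_in_tuples swap_first_map)

lemma apply_rows_nabla:
  "M \<in> matrices A m n \<Longrightarrow>
    apply_rows m (\<lambda>xs\<in>tuples A n. f (tl xs)) M = apply_rows m f (tl M)"
  by (rule apply_rows_cong) (simp add: row_in_tuples map_tl)

lemma apply_rows_comp:
  "M \<in> matrices A m n \<Longrightarrow>
    apply_rows m (\<lambda>xs\<in>tuples A n. f (g (take k xs) # drop k xs)) M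
      = apply_rows m f (apply_rows m g (take k M) # drop k M)"
  by (rule apply_rows_cong) (simp add: row_in_tuples apply_rows_def take_map drop_map)

section \<open>Preservation is stable under the closure conditions\<close>

lemma operations_zeta: "(n, f) \<in> operations A \<Longrightarrow> op_zeta A (n, f) \<in> operations A"
  by (auto simp: operations_def tuples_def PiE_iff)

lemma operations_tau: "(n, f) \<in> operations A \<Longrightarrow> op_tau A (n, f) \<in> operations A"
  using tuples_cong_mset[OF mset_swap_first] by (fastforce simp: operations_def PiE_iff)

lemma operations_nabla: "(n, f) \<in> operations A \<Longrightarrow> op_nabla A (n, f) \<in> operations A"
proof -
  have "tl xs \<in> tuples A n" if "xs \<in> tuples A (n + 1)" for xs
    using that by (cases xs) (auto simp: tuples_def)
  then show "(n, f) \<in> operations A \<Longrightarrow> op_nabla A (n, f) \<in> operations A"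
    by (auto simp: operations_def PiE_iff)
qed

lemma operations_comp:
  assumes "(n, f) \<in> operations A" "(k, g) \<in> operations A"
  shows "op_comp A (n, f) (k, g) \<in> operations A"
proof -
  have "f (g (take k xs) # drop k xs) \<in> A" if xs: "xs \<in> tuples A (k + n - 1)" for xs
  proof -
    have n: "n \<ge> 1"
      using assms by (simp add: operations_def)
    then have "take k xs \<in> tuples A k"
      using xs by (auto simp: tuples_def dest: in_set_takeD)
    then have "g (take k xs) \<in> A"
      using assms by (auto simp: operations_def PiE_iff)
    then have "g (take k xs) # drop k xs \<in> tuples A n"
      using xs n by (auto simp: tuples_def dest: in_set_dropD)
    then show ?thesis
      using assms by (auto simp: operations_def PiE_iff)
  qed
  then show ?thesis
    using assms by (auto simp: operations_def)
qed

lemma preserves_permuted: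
  assumes "preserves A (n, f) (m, \<Phi>, \<Phi>')" "\<And>M. mset (\<pi> M) = mset M"
    "\<And>M. M \<in> matrices A m n \<Longrightarrow> apply_rows m f' M = apply_rows m f (\<pi> M)"
  shows "preserves A (n, f') (m, \<Phi>, \<Phi>')"
  unfolding preserves.simps
proof (intro allI ballI impI)
  fix p M\<^sub>1 M\<^sub>2
  assume M: "M\<^sub>1 \<in> matrices A m n" "M\<^sub>2 \<in> matrices A m p" "prec (M\<^sub>1 @ M\<^sub>2) \<Phi>"
  then have "\<pi> M\<^sub>1 \<in> matrices A m n" "prec (\<pi> M\<^sub>1 @ M\<^sub>2) \<Phi>"
    using tuples_cong_mset[OF assms(2)] by (simp_all add: matrices_def prec_def assms(2))
  then show "prec_pointed ([apply_rows m f' M\<^sub>1] @ M\<^sub>2) \<Phi>'"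
    using assms(1,3) M by auto
qed

lemma preserves_nabla:
  assumes sys: "(m, \<Phi>, \<Phi>') \<in> pointed_multiset_systems A"
    and pres: "preserves A (n, f) (m, \<Phi>, \<Phi>')"
  shows "preserves A (op_nabla A (n, f)) (m, \<Phi>, \<Phi>')"
  unfolding op_nabla.simps preserves.simps
proof (intro allI ballI impI)
  fix p M\<^sub>1 M\<^sub>2
  assume M: "M\<^sub>1 \<in> matrices A m (n + 1)" "M\<^sub>2 \<in> matrices A m p" "prec (M\<^sub>1 @ M\<^sub>2) \<Phi>"
  then obtain c N where N: "M\<^sub>1 = c # N" "N \<in> matrices A m n" "c # M\<^sub>2 \<in> matrices A m (p + 1)"
    by (cases M\<^sub>1) (auto simp: matrices_def tuples_def)
  then have "prec (N @ c # M\<^sub>2) \<Phi>"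
    using M by (simp add: prec_def)
  then have "prec_pointed ([apply_rows m f N] @ c # M\<^sub>2) \<Phi>'"
    using pres N by auto
  \<comment> \<open>The column at the dummy position moves to the unused columns, and is then discarded.\<close>
  then have "(apply_rows m f N, mset M\<^sub>2) \<in> \<Phi>'"
    using sys by (fastforce simp: prec_pointed_def pointed_multiset_systems_def)
  then show "prec_pointed ([apply_rows m (\<lambda>xs\<in>tuples A (n + 1). f (tl xs)) M\<^sub>1] @ M\<^sub>2) \<Phi>'"
    using apply_rows_nabla[OF M(1)] N by (simp add: prec_pointed_def)
qed

text \<open>Since \<open>{x} \<uplus> S \<in> \<Phi>\<close> whenever \<open>(x, S) \<in> \<Phi>'\<close>, the result of applying \<open>g\<close> is again an
  admissible input for \<open>f\<close>.\<close>

lemma preserves_comp: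
  assumes sys: "(m, \<Phi>, \<Phi>') \<in> pointed_multiset_systems A"
    and ops: "(n, f) \<in> operations A" "(k, g) \<in> operations A"
    and pres_f: "preserves A (n, f) (m, \<Phi>, \<Phi>')"
    and pres_g: "preserves A (k, g) (m, \<Phi>, \<Phi>')"
  shows "preserves A (op_comp A (n, f) (k, g)) (m, \<Phi>, \<Phi>')"
  unfolding op_comp.simps preserves.simps
proof (intro allI ballI impI)
  fix p M\<^sub>1 M\<^sub>2
  assume M: "M\<^sub>1 \<in> matrices A m (k + n - 1)" "M\<^sub>2 \<in> matrices A m p" "prec (M\<^sub>1 @ M\<^sub>2) \<Phi>"
  define N\<^sub>1 N\<^sub>2 y where "N\<^sub>1 = take k M\<^sub>1" and "N\<^sub>2 = drop k M\<^sub>1" and "y = apply_rows m g N\<^sub>1"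
  have n: "n \<ge> 1"
    using ops by (simp add: operations_def)
  have split: "M\<^sub>1 = N\<^sub>1 @ N\<^sub>2"
    by (simp add: N\<^sub>1_def N\<^sub>2_def)
  have N\<^sub>1: "N\<^sub>1 \<in> matrices A m k"
    using M(1) n by (auto simp: N\<^sub>1_def matrices_def tuples_def dest: in_set_takeD)
  have N\<^sub>2: "N\<^sub>2 \<in> matrices A m (n - 1)"
    using M(1) n by (auto simp: N\<^sub>2_def matrices_def tuples_def dest: in_set_dropD)
  have "N\<^sub>2 @ M\<^sub>2 \<in> matrices A m (n - 1 + p)"
    using N\<^sub>2 M(2) by (auto simp: matrices_def tuples_def)
  moreover have "prec (N\<^sub>1 @ (N\<^sub>2 @ M\<^sub>2)) \<Phi>"
    using M(3) split by simp
  ultimately have "prec_pointed ([y] @ (N\<^sub>2 @ M\<^sub>2)) \<Phi>'"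
    using pres_g N\<^sub>1 unfolding y_def preserves.simps by blast
  then have "prec ((y # N\<^sub>2) @ M\<^sub>2) \<Phi>"
    using sys by (auto simp: prec_pointed_def prec_def pointed_multiset_systems_def)
  moreover have "y # N\<^sub>2 \<in> matrices A m n"
    using apply_rows_in_tuples[OF ops(2) N\<^sub>1] N\<^sub>2 n by (auto simp: y_def matrices_def tuples_def)
  ultimately have "prec_pointed ([apply_rows m f (y # N\<^sub>2)] @ M\<^sub>2) \<Phi>'"
    using pres_f M(2) by auto
  then show "prec_pointed ([apply_rows m
      (\<lambda>xs\<in>tuples A (k + n - 1). f (g (take k xs) # drop k xs)) M\<^sub>1] @ M\<^sub>2) \<Phi>'"
    using apply_rows_comp[OF M(1)] by (simp add: y_def N\<^sub>1_def N\<^sub>2_def)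
qed

text \<open>Preservation tests an operation on one matrix at a time, hence only on its finitely many rows.\<close>

lemma preserves_locally:
  assumes "\<And>X. finite X \<Longrightarrow> X \<subseteq> tuples A n \<Longrightarrow>
      \<exists>g. preserves A (n, g) (m, \<Phi>, \<Phi>') \<and> (\<forall>x\<in>X. f x = g x)"
  shows "preserves A (n, f) (m, \<Phi>, \<Phi>')"
  unfolding preserves.simps
proof (intro allI ballI impI)
  fix p M\<^sub>1 M\<^sub>2
  assume M: "M\<^sub>1 \<in> matrices A m n" "M\<^sub>2 \<in> matrices A m p" "prec (M\<^sub>1 @ M\<^sub>2) \<Phi>"
  have "(\<lambda>i. map (\<lambda>c. c ! i) M\<^sub>1) ` {..<m} \<subseteq> tuples A n"
    using row_in_tuples[OF M(1)] by blast
  then obtain g where g: "preserves A (n, g) (m, \<Phi>, \<Phi>')"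
      "\<forall>i<m. f (map (\<lambda>c. c ! i) M\<^sub>1) = g (map (\<lambda>c. c ! i) M\<^sub>1)"
    using assms[of "(\<lambda>i. map (\<lambda>c. c ! i) M\<^sub>1) ` {..<m}"] by auto
  then have "apply_rows m f M\<^sub>1 = apply_rows m g M\<^sub>1"
    by (intro apply_rows_cong) simp
  then show "prec_pointed ([apply_rows m f M\<^sub>1] @ M\<^sub>2) \<Phi>'"
    using g(1) M by auto
qed

lemma characterized_imp_closed:
  assumes W: "W \<subseteq> pointed_multiset_systems A"
    and F: "F = {f \<in> operations A. \<forall>\<Phi>\<in>W. preserves A f \<Phi>}"
  shows "locally_closed A F \<and> closed_permutation A F \<and> closed_dummy A F \<and> closed_composition A F"
proof (intro conjI)
  show "locally_closed A F"
    unfolding locally_closed_def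
  proof clarify
    fix n f
    assume f: "(n, f) \<in> operations A"
      and loc: "\<forall>X. finite X \<and> X \<subseteq> tuples A n \<longrightarrow> (\<exists>g. (n, g) \<in> F \<and> (\<forall>x\<in>X. f x = g x))"
    have "preserves A (n, f) (m, \<Phi>, \<Phi>')" if "(m, \<Phi>, \<Phi>') \<in> W" for m \<Phi> \<Phi>'
    proof (rule preserves_locally)
      fix X :: "'a list set"
      assume "finite X" "X \<subseteq> tuples A n"
      then obtain g where "(n, g) \<in> F" "\<forall>x\<in>X. f x = g x"
        using loc by blast
      then show "\<exists>g. preserves A (n, g) (m, \<Phi>, \<Phi>') \<and> (\<forall>x\<in>X. f x = g x)"
        using that F by blast
    qed
    then show "(n, f) \<in> F"
      using f F by auto
  qed
  show "closed_permutation A F"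
    unfolding closed_permutation_def
  proof clarify
    fix n f
    assume f: "(n, f) \<in> F"
    have "preserves A (op_zeta A (n, f)) (m, \<Phi>, \<Phi>') \<and> preserves A (op_tau A (n, f)) (m, \<Phi>, \<Phi>')"
      if "(m, \<Phi>, \<Phi>') \<in> W" for m \<Phi> \<Phi>'
    proof
      have pres: "preserves A (n, f) (m, \<Phi>, \<Phi>')"
        using f F that by blast
      show "preserves A (op_zeta A (n, f)) (m, \<Phi>, \<Phi>')"
        unfolding op_zeta.simps
        by (rule preserves_permuted[OF pres _ apply_rows_zeta]) simp_all
      show "preserves A (op_tau A (n, f)) (m, \<Phi>, \<Phi>')"
        unfolding op_tau.simps
        by (rule preserves_permuted[OF pres _ apply_rows_tau]) simp_all
    qed
    then show "op_zeta A (n, f) \<in> F \<and> op_tau A (n, f) \<in> F"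
      using f F operations_zeta operations_tau by auto
  qed
  show "closed_dummy A F"
    unfolding closed_dummy_def
  proof clarify
    fix n f
    assume f: "(n, f) \<in> F"
    have "preserves A (op_nabla A (n, f)) (m, \<Phi>, \<Phi>')" if "(m, \<Phi>, \<Phi>') \<in> W" for m \<Phi> \<Phi>'
      using preserves_nabla f F W that by blast
    then show "op_nabla A (n, f) \<in> F"
      using f F operations_nabla by auto
  qed
  show "closed_composition A F"
    unfolding closed_composition_def
  proof clarify
    fix n f k g
    assume fg: "(n, f) \<in> F" "(k, g) \<in> F"
    have "preserves A (op_comp A (n, f) (k, g)) (m, \<Phi>, \<Phi>')" if "(m, \<Phi>, \<Phi>') \<in> W" for m \<Phi> \<Phi>'
      using preserves_comp fg F W that by blast
    then show "op_comp A (n, f) (k, g) \<in> F"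
      using fg F operations_comp by auto
  qed
qed

section \<open>Rotation and one transposition generate all permutations\<close>

text \<open>The hypotheses go from the permuted list to the list itself because \<open>(\<zeta> h) N = h (rotate1 N)\<close>,
  and similarly for \<open>\<tau>\<close>: a column that \<open>F\<close> produces from the permuted list is produced
  from the original one.\<close>

lemma mset_invariant_if_rotate1_swap_first:
  assumes rot: "\<And>xs. P (rotate1 xs) \<Longrightarrow> P xs"
    and swap: "\<And>xs. P (swap_first xs) \<Longrightarrow> P xs"
    and "mset xs = mset ys" "P xs"
  shows "P ys"
proof -
  have rot_k: "P (rotate k xs) \<Longrightarrow> P xs" for k xs
  proof (induction k)
    case (Suc k)
    then show ?case
      using rot[of "rotate k xs"] by simp
  qed simp
  have app_comm: "P (xs @ ys) \<Longrightarrow> P (ys @ xs)" for xs ys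
    using rot_k[of "length ys" "ys @ xs"] by (simp add: rotate_append)
  \<comment> \<open>An adjacent transposition is the one at the front, conjugated by a rotation.\<close>
  have adj: "P (us @ y # x # vs)" if "P (us @ x # y # vs)" for us x y vs
  proof -
    have "P (x # y # vs @ us)"
      using app_comm that by fastforce
    then have "P (y # x # vs @ us)"
      using swap[of "y # x # vs @ us"] by simp
    then show ?thesis
      using app_comm[of "y # x # vs" us] by simp
  qed
  have to_front: "P (us @ y # vs @ ws)" if "P (us @ vs @ y # ws)" for us y vs ws
    using that
  proof (induction vs arbitrary: ws rule: rev_induct)
    case (snoc v vs)
    then show ?case
      using adj[of "us @ vs" v y ws] by simp
  qed simp
  have "P (us @ ys)" if "mset xs = mset ys" "P (us @ xs)" for us xs ys
    using that
  proof (induction ys arbitrary: us xs)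
    case (Cons y ys)
    then obtain vs ws where xs: "xs = vs @ y # ws"
      by (metis list.set_intros(1) mset_eq_setD split_list)
    then have "P ((us @ [y]) @ vs @ ws)"
      using to_front Cons.prems by simp
    then have "P ((us @ [y]) @ ys)"
      using Cons.prems xs by (intro Cons.IH) auto
    then show ?case
      by simp
  qed simp
  from this[of xs ys "[]"] show ?thesis
    using assms(3,4) by simp
qed

section \<open>Derivable columns\<close>

text \<open>
  Every element of \<open>T\<close> fills exactly one argument place. Variables cannot be identified, so the
  multiplicities matter, and \<open>F\<close> may lack projections, so a column of \<open>T\<close> need not be derivable
  from \<open>T\<close>.
\<close>

definition derivable :: "'a set \<Rightarrow> 'a oper set \<Rightarrow> nat \<Rightarrow> 'a list multiset \<Rightarrow> 'a list set" where
  "derivable A F m T = {apply_rows m h N |h n N. (n, h) \<in> F \<and> N \<in> matrices A m n \<and> mset N = T}"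

lemma derivableI:
  "(n, h) \<in> F \<Longrightarrow> N \<in> matrices A m n \<Longrightarrow> apply_rows m h N \<in> derivable A F m (mset N)"
  unfolding derivable_def by blast

text \<open>The order in which the columns are listed can be prescribed, as \<open>F\<close> is closed under
  permutation of variables.\<close>

lemma in_derivable_iff:
  assumes perm: "closed_permutation A F"
    and N: "N \<in> matrices A m n"
  shows "x \<in> derivable A F m (mset N) \<longleftrightarrow> (\<exists>h. (n, h) \<in> F \<and> x = apply_rows m h N)"
proof
  define P where "P = (\<lambda>N. N \<in> matrices A m n \<and> (\<exists>h. (n, h) \<in> F \<and> x = apply_rows m h N))"
  assume "x \<in> derivable A F m (mset N)"
  then obtain h k N' where h: "(k, h) \<in> F" "N' \<in> matrices A m k" "mset N' = mset N"
      "x = apply_rows m h N'"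
    unfolding derivable_def by blast
  have "k = n"
    using h N mset_eq_length[OF h(3)] by (simp add: matrices_def tuples_def)
  then have "P N'"
    using h by (auto simp: P_def)
  have "P N"
  proof (rule mset_invariant_if_rotate1_swap_first[of P, OF _ _ h(3) \<open>P N'\<close>])
    fix M
    assume "P (rotate1 M)"
    then obtain h where h: "(n, h) \<in> F" "x = apply_rows m h (rotate1 M)" and M: "M \<in> matrices A m n"
      by (auto simp: P_def matrices_def tuples_def)
    have "op_zeta A (n, h) \<in> F"
      using perm h(1) unfolding closed_permutation_def by blast
    then show "P M"
      using apply_rows_zeta[OF M, of h] h(2) M by (auto simp: P_def)
  next
    fix M
    assume "P (swap_first M)"
    then obtain h where h: "(n, h) \<in> F" "x = apply_rows m h (swap_first M)"
      and M: "M \<in> matrices A m n"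
      using tuples_cong_mset[OF mset_swap_first] by (auto simp: P_def matrices_def)
    have "op_tau A (n, h) \<in> F"
      using perm h(1) unfolding closed_permutation_def by blast
    then show "P M"
      using apply_rows_tau[OF M, of h] h(2) M by (auto simp: P_def)
  qed
  then show "\<exists>h. (n, h) \<in> F \<and> x = apply_rows m h N"
    by (simp add: P_def)
qed (use derivableI N in blast)

text \<open>Unused columns are absorbed by dummy variables.\<close>

lemma derivable_mono:
  assumes dummy: "closed_dummy A F"
    and "T' \<in> multisets_on (tuples A m)" "T \<subseteq># T'"
  shows "derivable A F m T \<subseteq> derivable A F m T'"
proof -
  have step: "derivable A F m T \<subseteq> derivable A F m (add_mset c T)" if c: "c \<in> tuples A m" for c T
  proof
    fix x
    assume "x \<in> derivable A F m T"
    then obtain h n N where h: "(n, h) \<in> F" "N \<in> matrices A m n" "mset N = T"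
        "x = apply_rows m h N"
      unfolding derivable_def by blast
    have "op_nabla A (n, h) \<in> F"
      using dummy h(1) unfolding closed_dummy_def by blast
    moreover have cN: "c # N \<in> matrices A m (n + 1)"
      using h(2) c by (simp add: matrices_def tuples_def)
    moreover have "x = apply_rows m (\<lambda>xs\<in>tuples A (n + 1). h (tl xs)) (c # N)"
      using apply_rows_nabla[OF cN] h(4) by simp
    ultimately show "x \<in> derivable A F m (add_mset c T)"
      using derivableI[of "n + 1" _ F "c # N" A m] h(3) by simp
  qed
  have add: "derivable A F m T \<subseteq> derivable A F m (T + U)" if "set_mset U \<subseteq> tuples A m" for U
    using that by (induction U) (use step in force)+
  have "set_mset (T' - T) \<subseteq> tuples A m"
    using assms(2) by (auto simp: multisets_on_def dest: in_diffD)
  from add[OF this] show ?thesis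
    using assms(3) by simp
qed

text \<open>Composition substitutes the derivation of \<open>y\<close> for one occurrence of \<open>y\<close>. Permutation of
  variables brings that occurrence to the first place, the only one into which \<open>\<ast>\<close> substitutes.\<close>

lemma derivable_cut:
  assumes F: "F \<subseteq> operations A"
    and perm: "closed_permutation A F" and comp: "closed_composition A F"
    and S: "S \<in> multisets_on (tuples A m)"
    and y: "y \<in> derivable A F m T" and x: "x \<in> derivable A F m ({#y#} + S)"
  shows "x \<in> derivable A F m (T + S)"
proof -
  obtain g k N where g: "(k, g) \<in> F" "N \<in> matrices A m k" "mset N = T" "y = apply_rows m g N"
    using y unfolding derivable_def by blast
  obtain L where L: "mset L = S"
    using ex_mset by blast
  define n where "n = length L + 1"
  have "y # L \<in> matrices A m n"
    using apply_rows_in_tuples[of k g A N m] g F S L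
    by (auto simp: n_def matrices_def tuples_def multisets_on_def)
  then obtain f where f: "(n, f) \<in> F" "x = apply_rows m f (y # L)"
    using x L in_derivable_iff[OF perm, of "y # L" m n x] by auto
  have "op_comp A (n, f) (k, g) \<in> F"
    using comp f(1) g(1) unfolding closed_composition_def by blast
  moreover have NL: "N @ L \<in> matrices A m (k + n - 1)"
    using g(2) \<open>y # L \<in> matrices A m n\<close> by (auto simp: n_def matrices_def tuples_def)
  moreover have "length N = k"
    using g(2) by (simp add: matrices_def tuples_def)
  then have "x = apply_rows m (\<lambda>xs\<in>tuples A (k + n - 1). f (g (take k xs) # drop k xs)) (N @ L)"
    using apply_rows_comp[OF NL] f(2) g(4) by simp
  ultimately show ?thesis
    using derivableI[of "k + n - 1" _ F "N @ L" A m] g(3) L by simp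
qed

section \<open>The systems that characterize a closed class\<close>

definition derivability_system :: "'a set \<Rightarrow> 'a oper set \<Rightarrow> nat \<Rightarrow> 'a list multiset \<Rightarrow> 'a pms" where
  "derivability_system A F m T =
     (let \<Phi> = {S \<in> multisets_on (tuples A m). derivable A F m S \<subseteq> derivable A F m T}
      in (m, \<Phi>, {(x, S). {#x#} + S \<in> \<Phi> \<and> x \<in> derivable A F m T}))"

lemma derivability_system_in_systems:
  assumes "closed_dummy A F" "m \<ge> 1"
  shows "derivability_system A F m T \<in> pointed_multiset_systems A"
proof -
  define \<Phi> where
    "\<Phi> = {S \<in> multisets_on (tuples A m). derivable A F m S \<subseteq> derivable A F m T}"
  have on: "\<Phi> \<subseteq> multisets_on (tuples A m)"
    by (auto simp: \<Phi>_def)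
  have down: "S' \<in> \<Phi>" if "S \<in> \<Phi>" "S' \<subseteq># S" for S S'
  proof -
    have "S' \<in> multisets_on (tuples A m)"
      using that on set_mset_mono[OF that(2)] by (auto simp: multisets_on_def)
    then show ?thesis
      using derivable_mono[OF assms(1) _ that(2)] that(1) unfolding \<Phi>_def by blast
  qed
  have "{#x#} + S' \<in> \<Phi>" if "{#x#} + S \<in> \<Phi>" "S' \<subseteq># S" for x S S'
    using down[OF that(1)] that(2) by simp
  moreover have "x \<in> tuples A m \<and> S \<in> multisets_on (tuples A m)" if "{#x#} + S \<in> \<Phi>" for x S
    using subsetD[OF on that] by (auto simp: multisets_on_def)
  ultimately show ?thesis
    using assms(2) on unfolding derivability_system_def pointed_multiset_systems_def Let_def
      \<Phi>_def[symmetric] by blast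
qed

lemma preserves_derivability_system:
  assumes F: "F \<subseteq> operations A" and perm: "closed_permutation A F"
    and dummy: "closed_dummy A F" and comp: "closed_composition A F"
    and f: "f \<in> F"
  shows "preserves A f (derivability_system A F m T)"
proof -
  obtain n g where [simp]: "f = (n, g)"
    by fastforce
  have "prec_pointed ([apply_rows m g M\<^sub>1] @ M\<^sub>2)
      {(x, S). {#x#} + S \<in> multisets_on (tuples A m) \<and>
        derivable A F m ({#x#} + S) \<subseteq> derivable A F m T \<and> x \<in> derivable A F m T}"
    if M: "M\<^sub>1 \<in> matrices A m n" "M\<^sub>2 \<in> matrices A m p"
      and sub: "derivable A F m (mset (M\<^sub>1 @ M\<^sub>2)) \<subseteq> derivable A F m T" for p M\<^sub>1 M\<^sub>2
  proof -
    have y: "apply_rows m g M\<^sub>1 \<in> derivable A F m (mset M\<^sub>1)"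
      using f M(1) by (auto intro: derivableI)
    have "apply_rows m g M\<^sub>1 \<in> tuples A m"
      using apply_rows_in_tuples[OF _ M(1), of g] f F by auto
    then have yM: "{#apply_rows m g M\<^sub>1#} + mset M\<^sub>2 \<in> multisets_on (tuples A m)"
      using M(2) by (auto simp: multisets_on_def matrices_def tuples_def)
    have M12: "mset (M\<^sub>1 @ M\<^sub>2) \<in> multisets_on (tuples A m)"
      using M by (auto simp: multisets_on_def matrices_def tuples_def)
    have "mset M\<^sub>2 \<in> multisets_on (tuples A m)"
      using M(2) by (auto simp: multisets_on_def matrices_def tuples_def)
    then have "derivable A F m ({#apply_rows m g M\<^sub>1#} + mset M\<^sub>2) \<subseteq> derivable A F m T"
      using derivable_cut[OF F perm comp _ y] sub by auto
    moreover have "apply_rows m g M\<^sub>1 \<in> derivable A F m T"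
      using derivable_mono[OF dummy M12, of "mset M\<^sub>1"] y sub by auto
    ultimately show ?thesis
      using yM by (simp add: prec_pointed_def)
  qed
  then show ?thesis
    by (auto simp: derivability_system_def Let_def prec_def)
qed

lemma exists_matrix_with_rows:
  assumes "finite X" "X \<subseteq> tuples A n" "X \<noteq> {}"
  obtains m M where "m \<ge> 1" "M \<in> matrices A m n" "X = (\<lambda>i. map (\<lambda>c. c ! i) M) ` {..<m}"
proof -
  obtain rs where rs: "set rs = X"
    using assms(1) finite_list by blast
  define M where "M = map (\<lambda>j. map (\<lambda>r. r ! j) rs) [0..<n]"
  have row: "map (\<lambda>c. c ! i) M = rs ! i" if "i < length rs" for i
    using that assms(2) rs nth_mem[OF that]
    by (auto simp: M_def tuples_def intro!: nth_equalityI)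
  have "X = (\<lambda>i. rs ! i) ` {..<length rs}"
    using rs by (auto simp: in_set_conv_nth)
  then have "X = (\<lambda>i. map (\<lambda>c. c ! i) M) ` {..<length rs}"
    using row by simp
  moreover have "M \<in> matrices A (length rs) n"
    using assms(2) rs by (fastforce simp: M_def matrices_def tuples_def)
  moreover have "length rs \<ge> 1"
    using rs assms(3) by (cases rs) auto
  ultimately show thesis
    using that by blast
qed

lemma agrees_if_preserves_derivability_systems:
  assumes "A \<noteq> {}" and perm: "closed_permutation A F"
    and pres: "\<And>m T. m \<ge> 1 \<Longrightarrow> preserves A (n, f) (derivability_system A F m T)"
    and X: "finite X" "X \<subseteq> tuples A n"
  shows "\<exists>g. (n, g) \<in> F \<and> (\<forall>x\<in>X. f x = g x)"
proof -
  obtain a where "a \<in> A"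
    using assms(1) by blast
  then have rX: "insert (replicate n a) X \<subseteq> tuples A n"
    using X by (auto simp: tuples_def)
  \<comment> \<open>An extra row keeps the number of rows positive when \<open>X\<close> is empty.\<close>
  obtain m M where m: "m \<ge> 1" and M: "M \<in> matrices A m n"
    and rows: "insert (replicate n a) X = (\<lambda>i. map (\<lambda>c. c ! i) M) ` {..<m}"
    using exists_matrix_with_rows[OF _ rX] X(1) by blast
  have "prec_pointed ([apply_rows m f M] @ [])
      {(x, S). {#x#} + S \<in> multisets_on (tuples A m) \<and>
        derivable A F m ({#x#} + S) \<subseteq> derivable A F m (mset M) \<and> x \<in> derivable A F m (mset M)}"
    using pres[OF m, of "mset M"] M
    by (auto simp: derivability_system_def Let_def prec_def matrices_def tuples_def
        multisets_on_def dest!: spec[of _ "0::nat"])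
  then have "apply_rows m f M \<in> derivable A F m (mset M)"
    by (simp add: prec_pointed_def)
  then obtain g where "(n, g) \<in> F" "apply_rows m f M = apply_rows m g M"
    using in_derivable_iff[OF perm M] by auto
  moreover from this have "\<forall>x\<in>insert (replicate n a) X. f x = g x"
    unfolding rows by (auto simp: apply_rows_def)
  ultimately show ?thesis
    by blast
qed

theorem theorem2p4:
  fixes A :: "'a set" and F :: "'a oper set"
  assumes "A \<noteq> {}" and "F \<subseteq> operations A"
  shows "(locally_closed A F \<and> closed_permutation A F \<and> closed_dummy A F \<and> closed_composition A F)
    \<longleftrightarrow> (\<exists>W \<subseteq> pointed_multiset_systems A.
          F = {f \<in> operations A. \<forall>\<Phi>\<in>W. preserves A f \<Phi>})"
proof
  assume closed: "locally_closed A F \<and> closed_permutation A F \<and> closed_dummy A F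
    \<and> closed_composition A F"
  define W where "W = {derivability_system A F m T |m T. m \<ge> 1}"
  have "W \<subseteq> pointed_multiset_systems A"
    using derivability_system_in_systems closed by (auto simp: W_def)
  moreover have "F = {f \<in> operations A. \<forall>\<Phi>\<in>W. preserves A f \<Phi>}"
  proof (intro equalityI subsetI)
    fix f
    assume "f \<in> F"
    then show "f \<in> {f \<in> operations A. \<forall>\<Phi>\<in>W. preserves A f \<Phi>}"
      using preserves_derivability_system[OF assms(2)] closed assms(2) unfolding W_def by blast
  next
    fix f
    assume f: "f \<in> {f \<in> operations A. \<forall>\<Phi>\<in>W. preserves A f \<Phi>}"
    obtain n g where [simp]: "f = (n, g)"
      by fastforce
    have pres: "preserves A (n, g) (derivability_system A F m T)" if "m \<ge> 1" for m T
      using f \<open>f = (n, g)\<close> that unfolding W_def by blast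
    have "\<exists>h. (n, h) \<in> F \<and> (\<forall>x\<in>X. g x = h x)" if "finite X" "X \<subseteq> tuples A n" for X
      using agrees_if_preserves_derivability_systems[OF assms(1) _ pres that] closed by blast
    then show "f \<in> F"
      using closed f unfolding locally_closed_def by fastforce
  qed
  ultimately show "\<exists>W \<subseteq> pointed_multiset_systems A.
      F = {f \<in> operations A. \<forall>\<Phi>\<in>W. preserves A f \<Phi>}"
    by blast
next
  assume "\<exists>W \<subseteq> pointed_multiset_systems A. F = {f \<in> operations A. \<forall>\<Phi>\<in>W. preserves A f \<Phi>}"
  then show "locally_closed A F \<and> closed_permutation A F \<and> closed_dummy A F
      \<and> closed_composition A F"
    using characterized_imp_closed by blast
qed

end
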